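(* Consider the real matched pairs of Lie algebras of dimension $2+1$ in the list 1.1–4.3 given in the context (with generators $X,Y$ of $\mathfrak g_1$). The group of extensions is $\mathbb R$ in the cases 1.1, 2.1, 2.2, 2.3, 3 (with $a=-1$), 4.1 (with $d=-1$), 4.2 (with $d=-1$) and 4.3; the cocycles are defined by $\mathcal U(X,Y)=\lambda$, for $\lambda\in\mathbb R$. In the other cases of the list, the group of extensions is trivial.
   Context: A real matched pair of Lie algebras of dimension $2+1$ consists of a Lie algebra $\mathfrak g=\mathfrak g_1\oplus\mathfrak g_2$ (vector space direct sum of Lie subalgebras) with $\dim\mathfrak g_1=2$ and $\mathfrak g_2=\mathbb RA$. It is described by the bracket on $\mathfrak g_1$ and the linear maps $\beta:\mathfrak g_1\to\mathfrak g_1$, $\chi:\mathfrak g_1\to\mathbb R$ given by $[X,A]=\beta(X)+\chi(X)A$. List (generators $X,Y$ of $\mathfrak g_1$): 1. $\chi=0,\beta=0$: 1.1 $[X,Y]=0$; 1.2 $[X,Y]=Y$. 2. $\chi=0$, $\beta\neq0$: 2.1 $[X,Y]=0$, $\beta(X)=X$, $\beta(Y)=rY$, $-1\le r\le1$; 2.2 $[X,Y]=0$, $\beta(X)=X+Y$, $\beta(Y)=Y$; 2.3 $[X,Y]=0$, $\beta(X)=Y$, $\beta(Y)=0$; 2.4 $[X,Y]=Y$, $\beta(X)=Y$, $\beta(Y)=0$; 2.5 $[X,Y]=Y$, $\beta(X)=0$, $\beta(Y)=Y$. 3. $\chi\neq0$, $\beta=0$: $[X,Y]=aY$, $\chi(X)=1$,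 $\chi(Y)=0$, $a\in\mathbb R$. 4. $\chi(X)=1$, $\chi(Y)=0$, $\beta\neq0$: 4.1 $[X,Y]=dY$, $\beta(X)=X+bY$, $\beta(Y)=dY$, either $d=1$ and $b\in\mathbb R$, or $d\neq1$ and $b=0$; 4.2 $[X,Y]=dY$, $\beta(X)=Y$, $\beta(Y)=0$, $d\in\mathbb R$; 4.3 $[X,Y]=-Y$, $\beta(X)=aY$, $\beta(Y)=X$, $a=1,0,-1$. 2-cocycles: for a matched pair with $\dim\mathfrak g_2=1$, a 2-cocycle is an antisymmetric bilinear form $\mathcal U$ on $\mathfrak g_1$ with values in $\mathbb R$ such that $\mathcal U([X,Y],Z)+\chi(X)\,\mathcal U(Y,Z)+(\text{cyclic permutations})=0$ for all $X,Y,Z\in\mathfrak g_1$. It is cohomologous to trivial if there is a linear form $\rho\in\mathfrak g_1^*$ with $\mathcal U(X,Y)=\rho([X,Y])+\chi(X)\rho(Y)-\chi(Y)\rho(X)$ for all $X,Y\in\mathfrak g_1$. The group of extensions is the quotient of the space of 2-cocycles by those cohomologous to trivial, with addition. *)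

theory Defs
  imports "HOL-Analysis.Analysis" "HOL-Algebra.Elementary_Groups"
begin

locale lie_algebra =
  fixes br :: "'g::real_vector \<Rightarrow> 'g \<Rightarrow> 'g"
  assumes bilinear_br: "bilinear br"
    and br_self: "br x x = 0"
    and jacobi: "br (br x y) z + br (br y z) x + br (br z x) y = 0"

locale matched_pair = lie_algebra br
  for br :: "'g::real_vector \<Rightarrow> 'g \<Rightarrow> 'g" +
  fixes g1 g2 :: "'g set"
  assumes subspace_g1: "subspace g1"
    and subspace_g2: "subspace g2"
    and br_g1: "\<lbrakk>x \<in> g1; y \<in> g1\<rbrakk> \<Longrightarrow> br x y \<in> g1"
    and br_g2: "\<lbrakk>x \<in> g2; y \<in> g2\<rbrakk> \<Longrightarrow> br x y \<in> g2"
    and g1_Int_g2: "g1 \<inter> g2 = {0}"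
    and g1_plus_g2: "\<exists>x\<in>g1. \<exists>y\<in>g2. z = x + y"

text \<open>
  The last assumption determines \<open>\<beta>\<close> and \<open>chi\<close> on \<open>g1\<close>, and they are then linear there.  Their
  values outside \<open>g1\<close> are irrelevant.
\<close>

locale matched_pair_2_1 = matched_pair br g1 "span {A}"
  for br :: "'g::real_vector \<Rightarrow> 'g \<Rightarrow> 'g" and g1 :: "'g set" and A :: 'g +
  fixes \<beta> :: "'g \<Rightarrow> 'g" and chi :: "'g \<Rightarrow> real"
  assumes dim_g1: "dim g1 = 2"
    and A_nonzero: "A \<noteq> 0"
    and br_A: "x \<in> g1 \<Longrightarrow> \<beta> x \<in> g1 \<and> br x A = \<beta> x + chi x *\<^sub>R A"

text \<open>
  The entries of the list together with their parameters; \<open>Case_4_1 d b\<close> has its parameters in this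
  order.
\<close>

datatype list_case =
    Case_1_1 | Case_1_2
  | Case_2_1 real | Case_2_2 | Case_2_3 | Case_2_4 | Case_2_5
  | Case_3 real
  | Case_4_1 real real | Case_4_2 real | Case_4_3 real

fun admissible :: "list_case \<Rightarrow> bool" where
  "admissible (Case_2_1 r) \<longleftrightarrow> -1 \<le> r \<and> r \<le> 1"
| "admissible (Case_4_1 d b) \<longleftrightarrow> d = 1 \<or> (d \<noteq> 1 \<and> b = 0)"
| "admissible (Case_4_3 a) \<longleftrightarrow> a \<in> {1, 0, -1}"
| "admissible _ \<longleftrightarrow> True"

fun of_case ::
  "('g::real_vector \<Rightarrow> 'g \<Rightarrow> 'g) \<Rightarrow> 'g set \<Rightarrow> ('g \<Rightarrow> 'g) \<Rightarrow> ('g \<Rightarrow> real) \<Rightarrow> 'g \<Rightarrow> 'g \<Rightarrow> list_case \<Rightarrow> bool"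
where
  "of_case br g1 \<beta> chi X Y Case_1_1 \<longleftrightarrow>
     (\<forall>Z\<in>g1. chi Z = 0) \<and> (\<forall>Z\<in>g1. \<beta> Z = 0) \<and> br X Y = 0"
| "of_case br g1 \<beta> chi X Y Case_1_2 \<longleftrightarrow>
     (\<forall>Z\<in>g1. chi Z = 0) \<and> (\<forall>Z\<in>g1. \<beta> Z = 0) \<and> br X Y = Y"
| "of_case br g1 \<beta> chi X Y (Case_2_1 r) \<longleftrightarrow>
     (\<forall>Z\<in>g1. chi Z = 0) \<and> br X Y = 0 \<and> \<beta> X = X \<and> \<beta> Y = r *\<^sub>R Y"
| "of_case br g1 \<beta> chi X Y Case_2_2 \<longleftrightarrow>
     (\<forall>Z\<in>g1. chi Z = 0) \<and> br X Y = 0 \<and> \<beta> X = X + Y \<and> \<beta> Y = Y"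
| "of_case br g1 \<beta> chi X Y Case_2_3 \<longleftrightarrow>
     (\<forall>Z\<in>g1. chi Z = 0) \<and> br X Y = 0 \<and> \<beta> X = Y \<and> \<beta> Y = 0"
| "of_case br g1 \<beta> chi X Y Case_2_4 \<longleftrightarrow>
     (\<forall>Z\<in>g1. chi Z = 0) \<and> br X Y = Y \<and> \<beta> X = Y \<and> \<beta> Y = 0"
| "of_case br g1 \<beta> chi X Y Case_2_5 \<longleftrightarrow>
     (\<forall>Z\<in>g1. chi Z = 0) \<and> br X Y = Y \<and> \<beta> X = 0 \<and> \<beta> Y = Y"
| "of_case br g1 \<beta> chi X Y (Case_3 a) \<longleftrightarrow>
     (\<forall>Z\<in>g1. \<beta> Z = 0) \<and> br X Y = a *\<^sub>R Y \<and> chi X = 1 \<and> chi Y = 0"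
| "of_case br g1 \<beta> chi X Y (Case_4_1 d b) \<longleftrightarrow>
     chi X = 1 \<and> chi Y = 0 \<and> br X Y = d *\<^sub>R Y \<and> \<beta> X = X + b *\<^sub>R Y \<and> \<beta> Y = d *\<^sub>R Y"
| "of_case br g1 \<beta> chi X Y (Case_4_2 d) \<longleftrightarrow>
     chi X = 1 \<and> chi Y = 0 \<and> br X Y = d *\<^sub>R Y \<and> \<beta> X = Y \<and> \<beta> Y = 0"
| "of_case br g1 \<beta> chi X Y (Case_4_3 a) \<longleftrightarrow>
     chi X = 1 \<and> chi Y = 0 \<and> br X Y = - Y \<and> \<beta> X = a *\<^sub>R Y \<and> \<beta> Y = X"

definition linear_form_on :: "'g::real_vector set \<Rightarrow> ('g \<Rightarrow> real) \<Rightarrow> bool" where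
  "linear_form_on S \<rho> \<longleftrightarrow>
     (\<forall>x\<in>S. \<forall>y\<in>S. \<rho> (x + y) = \<rho> x + \<rho> y) \<and> (\<forall>c. \<forall>x\<in>S. \<rho> (c *\<^sub>R x) = c * \<rho> x)"

definition antisym_bilinear_form_on :: "'g::real_vector set \<Rightarrow> ('g \<times> 'g \<Rightarrow> real) \<Rightarrow> bool" where
  "antisym_bilinear_form_on S U \<longleftrightarrow>
     (\<forall>x\<in>S. linear_form_on S (\<lambda>y. U (x, y))) \<and>
     (\<forall>y\<in>S. linear_form_on S (\<lambda>x. U (x, y))) \<and>
     (\<forall>x\<in>S. \<forall>y\<in>S. U (x, y) = - U (y, x))"

text \<open>
  A form on \<open>g1\<close> is represented by a function on pairs that is \<open>extensional\<close> on \<open>g1 \<times> g1\<close>, so that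
  equality of representatives is equality of forms.
\<close>

definition cocycles ::
  "('g::real_vector \<Rightarrow> 'g \<Rightarrow> 'g) \<Rightarrow> 'g set \<Rightarrow> ('g \<Rightarrow> real) \<Rightarrow> ('g \<times> 'g \<Rightarrow> real) set"
where
  "cocycles br g1 chi = {U \<in> extensional (g1 \<times> g1).
     antisym_bilinear_form_on g1 U \<and>
     (\<forall>x\<in>g1. \<forall>y\<in>g1. \<forall>z\<in>g1.
        (U (br x y, z) + chi x * U (y, z)) +
        (U (br y z, x) + chi y * U (z, x)) +
        (U (br z x, y) + chi z * U (x, y)) = 0)}"

definition trivial_cocycles ::
  "('g::real_vector \<Rightarrow> 'g \<Rightarrow> 'g) \<Rightarrow> 'g set \<Rightarrow> ('g \<Rightarrow> real) \<Rightarrow> ('g \<times> 'g \<Rightarrow> real) set"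
where
  "trivial_cocycles br g1 chi = {U \<in> cocycles br g1 chi.
     \<exists>\<rho>. linear_form_on g1 \<rho> \<and>
       (\<forall>x\<in>g1. \<forall>y\<in>g1. U (x, y) = \<rho> (br x y) + chi x * \<rho> y - chi y * \<rho> x)}"

definition cocycle_group ::
  "('g::real_vector \<Rightarrow> 'g \<Rightarrow> 'g) \<Rightarrow> 'g set \<Rightarrow> ('g \<Rightarrow> real) \<Rightarrow> ('g \<times> 'g \<Rightarrow> real) monoid"
where
  "cocycle_group br g1 chi =
     \<lparr>carrier = cocycles br g1 chi,
      mult = (\<lambda>U V. restrict (\<lambda>p. U p + V p) (g1 \<times> g1)),
      one = restrict (\<lambda>p. 0) (g1 \<times> g1)\<rparr>"

definition extension_group ::
  "('g::real_vector \<Rightarrow> 'g \<Rightarrow> 'g) \<Rightarrow> 'g set \<Rightarrow> ('g \<Rightarrow> real) \<Rightarrow> ('g \<times> 'g \<Rightarrow> real) set monoid"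
where
  "extension_group br g1 chi = cocycle_group br g1 chi Mod trivial_cocycles br g1 chi"

definition real_group :: "real monoid" where
  "real_group = \<lparr>carrier = UNIV, mult = (+), one = 0\<rparr>"

text \<open>
  The hypotheses of the list are consistent: every admissible entry is realized on \<open>\<real>\<^sup>3\<close>, with
  \<open>X\<close>, \<open>Y\<close>, \<open>A\<close> the standard basis.
\<close>

definition model_br ::
  "real \<Rightarrow> real \<times> real \<Rightarrow> real \<times> real \<Rightarrow> real \<Rightarrow>
   real \<times> real \<times> real \<Rightarrow> real \<times> real \<times> real \<Rightarrow> real \<times> real \<times> real"
where
  "model_br c bX bY e = (\<lambda>(u1, u2, u3) (v1, v2, v3).
     ((u1 * v3 - u3 * v1) * fst bX + (u2 * v3 - u3 * v2) * fst bY,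
      (u1 * v2 - u2 * v1) * c + (u1 * v3 - u3 * v1) * snd bX + (u2 * v3 - u3 * v2) * snd bY,
      (u1 * v3 - u3 * v1) * e))"

lemma matched_pair_model:
  fixes c e :: real and bX bY :: "real \<times> real"
  assumes jX: "(c + e) * fst bY = 0" and jY: "e * snd bY = fst bX * c"
  shows "matched_pair_2_1 (model_br c bX bY e) {v. snd (snd v) = 0} (0, 0, 1)
    (\<lambda>(x, y, z). (x * fst bX + y * fst bY, x * snd bX + y * snd bY, 0)) (\<lambda>(x, y, z). x * e)"
proof -
  obtain p q where bX: "bX = (p, q)" by (cases bX)
  obtain r s where bY: "bY = (r, s)" by (cases bY)
  have j: "(c + e) * r = 0" "e * s = p * c"
    using jX jY by (simp_all add: bX bY)
  have er: "e * r = - (c * r)" using j(1) by (simp add: algebra_simps)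
  have sp: "span {(0, 0, 1) :: real \<times> real \<times> real} = {v. fst v = 0 \<and> fst (snd v) = 0}"
    by (auto simp: span_singleton prod_eq_iff)
  have g1: "{v :: real \<times> real \<times> real. snd (snd v) = 0} = span {(1, 0, 0), (0, 1, 0)}"
    by (auto simp: span_insert span_singleton prod_eq_iff)
  have ind: "independent {(1, 0, 0), (0, 1, 0) :: real \<times> real \<times> real}"
    by (auto simp: independent_insert span_singleton prod_eq_iff)
  show ?thesis
  proof
    show "bilinear (model_br c bX bY e)"
      by (auto simp: bilinear_def linear_iff model_br_def algebra_simps split: prod.splits)
    show "model_br c bX bY e x x = 0" for x
      by (auto simp: model_br_def zero_prod_def algebra_simps split: prod.splits)
    show "model_br c bX bY e (model_br c bX bY e x y) z
        + model_br c bX bY e (model_br c bX bY e y z) x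
        + model_br c bX bY e (model_br c bX bY e z x) y = 0" for x y z
    proof -
      obtain x1 x2 x3 where x: "x = (x1, x2, x3)" by (cases x)
      obtain y1 y2 y3 where y: "y = (y1, y2, y3)" by (cases y)
      obtain z1 z2 z3 where z: "z = (z1, z2, z3)" by (cases z)
      show ?thesis
        unfolding x y z model_br_def bX bY split_conv fst_conv snd_conv add_Pair zero_prod_def
          prod.inject
        by (intro conjI) ((use j in algebra) | (simp add: algebra_simps))+
    qed
  next
    show "subspace {v :: real \<times> real \<times> real. snd (snd v) = 0}"
      by (auto simp: subspace_def)
    show "subspace (span {(0, 0, 1) :: real \<times> real \<times> real})"
      by (rule subspace_span)
    show "model_br c bX bY e x y \<in> {v. snd (snd v) = 0}"
      if "x \<in> {v. snd (snd v) = 0}" "y \<in> {v. snd (snd v) = 0}" for x y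
      using that by (auto simp: model_br_def split: prod.splits)
    show "model_br c bX bY e x y \<in> span {(0, 0, 1)}"
      if "x \<in> span {(0, 0, 1)}" "y \<in> span {(0, 0, 1)}" for x y
      using that unfolding sp by (auto simp: model_br_def split: prod.splits)
    show "{v. snd (snd v) = 0} \<inter> span {(0, 0, 1) :: real \<times> real \<times> real} = {0}"
      unfolding sp by (auto simp: prod_eq_iff)
    show "\<exists>x\<in>{v. snd (snd v) = 0}. \<exists>y\<in>span {(0, 0, 1)}. z = x + y"
      for z :: "real \<times> real \<times> real"
    proof -
      obtain z1 z2 z3 where z: "z = (z1, z2, z3)" by (cases z)
      have "z = (z1, z2, 0) + (0, 0, z3)" by (simp add: z)
      then show ?thesis unfolding sp by force
    qed
    show "dim {v :: real \<times> real \<times> real. snd (snd v) = 0} = 2"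
      unfolding g1 dim_span using dim_eq_card_independent[OF ind] by simp
    show "(0, 0, 1) \<noteq> (0 :: real \<times> real \<times> real)"
      by (simp add: prod_eq_iff)
  qed (auto simp: model_br_def split: prod.splits)
qed

lemma list_realized:
  assumes "admissible c"
  shows "\<exists>(br :: real \<times> real \<times> real \<Rightarrow> _) g1 A \<beta> chi X Y.
    matched_pair_2_1 br g1 A \<beta> chi \<and> span {X, Y} = g1 \<and> of_case br g1 \<beta> chi X Y c"
proof -
  have g1: "span {(1, 0, 0), (0, 1, 0)} = {v :: real \<times> real \<times> real. snd (snd v) = 0}"
    by (auto simp: span_insert span_singleton prod_eq_iff)
  have real: ?thesis
    if "(k + e) * fst bY = 0" "e * snd bY = fst bX * k"
      and "of_case (model_br k bX bY e) {v. snd (snd v) = 0}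
        (\<lambda>(x, y, z). (x * fst bX + y * fst bY, x * snd bX + y * snd bY, 0)) (\<lambda>(x, y, z). x * e)
        (1, 0, 0) (0, 1, 0) c" for k e bX bY
    using matched_pair_model[OF that(1,2)] g1 that(3) by blast
  show ?thesis
  proof (cases c)
    case Case_1_1
    then show ?thesis by (intro real[of 0 0 "(0, 0)" "(0, 0)"]) (auto simp: model_br_def zero_prod_def)
  next
    case Case_1_2
    then show ?thesis by (intro real[of 1 0 "(0, 0)" "(0, 0)"]) (auto simp: model_br_def zero_prod_def)
  next
    case (Case_2_1 r)
    then show ?thesis by (intro real[of 0 0 "(0, r)" "(1, 0)"]) (auto simp: model_br_def zero_prod_def)
  next
    case Case_2_2
    then show ?thesis by (intro real[of 0 0 "(0, 1)" "(1, 1)"]) (auto simp: model_br_def zero_prod_def)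
  next
    case Case_2_3
    then show ?thesis by (intro real[of 0 0 "(0, 0)" "(0, 1)"]) (auto simp: model_br_def zero_prod_def)
  next
    case Case_2_4
    then show ?thesis by (intro real[of 1 0 "(0, 0)" "(0, 1)"]) (auto simp: model_br_def zero_prod_def)
  next
    case Case_2_5
    then show ?thesis by (intro real[of 1 0 "(0, 1)" "(0, 0)"]) (auto simp: model_br_def zero_prod_def)
  next
    case (Case_3 a)
    then show ?thesis by (intro real[of a 1 "(0, 0)" "(0, 0)"]) (auto simp: model_br_def zero_prod_def)
  next
    case (Case_4_1 d b)
    then show ?thesis by (intro real[of d 1 "(0, d)" "(1, b)"]) (auto simp: model_br_def zero_prod_def)
  next
    case (Case_4_2 d)
    then show ?thesis by (intro real[of d 1 "(0, 0)" "(0, 1)"]) (auto simp: model_br_def zero_prod_def)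
  next
    case (Case_4_3 a)
    then show ?thesis by (intro real[of "-1" 1 "(1, 0)" "(0, a)"]) (auto simp: model_br_def zero_prod_def)
  qed
qed

end

theory Submission
  imports Defs
begin

text \<open>
  Since \<open>g1\<close> has dimension two, an alternating bilinear form on it is a multiple of the area form
  normalized on \<open>(X, Y)\<close>, and the cocycle condition, being alternating in three variables, is vacuous.
  So the cocycles are parametrized by \<open>U (X, Y)\<close>.  The trivial cocycle of a linear form \<open>\<rho>\<close> has the
  value \<open>\<rho> W\<close> on \<open>(X, Y)\<close>, where \<open>W = [X, Y] + \<chi>(X) Y - \<chi>(Y) X\<close>.  Hence the extension group is
  \<open>\<real>\<close> if \<open>W = 0\<close> and trivial otherwise.  In the list, \<open>W\<close> is a multiple of \<open>Y\<close>.
\<close>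

section \<open>The additive reals and the two extreme quotients of a group\<close>

lemma group_real_group: "group real_group"
proof (rule groupI)
  show "\<exists>y\<in>carrier real_group. y \<otimes>\<^bsub>real_group\<^esub> x = \<one>\<^bsub>real_group\<^esub>" for x
    by (simp add: real_group_def) (metis add.left_inverse)
qed (simp_all add: real_group_def)

text \<open>Every right coset of the whole group is the whole group again. This serves the case
  \<open>W \<noteq> 0\<close>, where all cocycles are trivial.\<close>

lemma (in group) trivial_group_Mod_self: "trivial_group (G Mod carrier G)"
proof -
  interpret N: normal "carrier G" G
    by (simp add: normal_inv_iff subgroup_self)
  have "group (G Mod carrier G)"
    by (rule N.factorgroup_is_group)
  moreover have "carrier (G Mod carrier G) = {carrier G}"
    using coset_join2[OF _ subgroup_self]
    by (auto simp: FactGroup_def RCOSETS_def)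
  ultimately show ?thesis
    by (simp add: group.trivial_group)
qed

text \<open>The cosets of the trivial subgroup are singletons. This serves the case
  \<open>W = 0\<close>, where zero is the only trivial cocycle.\<close>

lemma (in group) r_coset_one_iso: "(\<lambda>x. {\<one>} #> x) \<in> iso G (G Mod {\<one>})"
proof (rule isoI)
  show "(\<lambda>x. {\<one>} #> x) \<in> hom G (G Mod {\<one>})"
    by (rule normal.r_coset_hom_Mod[OF one_is_normal])
  show "bij_betw (\<lambda>x. {\<one>} #> x) (carrier G) (carrier (G Mod {\<one>}))"
    by (auto simp: bij_betw_def inj_on_def FactGroup_def RCOSETS_def r_coset_def)
qed

section \<open>Coordinates on \<open>g1\<close>\<close>

locale matched_pair_basis = matched_pair_2_1 br g1 A \<beta> chi
  for br :: "'g::real_vector \<Rightarrow> 'g \<Rightarrow> 'g" and g1 A \<beta> chi +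
  fixes X Y :: 'g
  assumes span_XY: "span {X, Y} = g1"
begin

lemma X_neq_Y: "X \<noteq> Y"
proof
  assume "X = Y"
  then have "dim g1 \<le> 1"
    using dim_le_card[of g1 "{Y}"] span_XY by simp
  then show False using dim_g1 by simp
qed

text \<open>A basis extracted from \<open>{X, Y}\<close> has \<open>dim g1 = 2\<close> elements,
  hence omits neither vector.\<close>

lemma independent_XY: "independent {X, Y}"
proof -
  obtain B where B: "B \<subseteq> {X, Y}" "independent B" "{X, Y} \<subseteq> span B" "card B = dim {X, Y}"
    using basis_exists by blast
  have "card B = 2"
    using B(4) dim_g1 span_XY dim_span[of "{X, Y}"] by simp
  then have "B = {X, Y}"
    using X_neq_Y by (intro card_subset_eq B(1)) auto
  then show ?thesis using B(2) by simp
qed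

lemma X_in [simp]: "X \<in> g1" and Y_in [simp]: "Y \<in> g1"
  by (simp_all add: span_base flip: span_XY)

text \<open>The coordinate along \<open>X\<close>, extended linearly to the ambient space, so that
  linearity can be applied without membership in \<open>g1\<close>.\<close>

definition px :: "'g \<Rightarrow> real" where
  "px = construct {X, Y} (\<lambda>v. if v = X then 1 else 0)"

definition py :: "'g \<Rightarrow> real" where
  "py = construct {X, Y} (\<lambda>v. if v = Y then 1 else 0)"

lemma linear_px: "linear px" and linear_py: "linear py"
  by (simp_all add: px_def py_def linear_construct independent_XY)

lemmas coord_simps =
  linear_add[OF linear_px] linear_scale[OF linear_px]
  linear_add[OF linear_py] linear_scale[OF linear_py]

lemma coord_basis [simp]: "px X = 1" "px Y = 0" "py X = 0" "py Y = 1"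
  using X_neq_Y by (simp_all add: px_def py_def construct_basis independent_XY)

lemma coord:
  assumes "v \<in> g1"
  shows "v = px v *\<^sub>R X + py v *\<^sub>R Y"
proof -
  obtain a b where "v - a *\<^sub>R X = b *\<^sub>R Y"
    using assms span_XY by (auto simp: span_insert span_singleton)
  then have v: "v = a *\<^sub>R X + b *\<^sub>R Y"
    by (simp add: algebra_simps)
  then have "px v = a" "py v = b"
    by (simp_all add: coord_simps)
  then show ?thesis using v by simp
qed

section \<open>Alternating forms, the bracket and \<open>chi\<close> in coordinates\<close>

definition area :: "'g \<Rightarrow> 'g \<Rightarrow> real" where
  "area x y = px x * py y - py x * px y"

lemma linear_form_on_coord:
  assumes "linear_form_on g1 f" "v \<in> g1"
  shows "f v = px v * f X + py v * f Y"
proof -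
  have "f v = f (px v *\<^sub>R X + py v *\<^sub>R Y)"
    using coord[OF assms(2)] by simp
  also have "\<dots> = px v * f X + py v * f Y"
    using assms(1) subspace_scale[OF subspace_g1] by (simp add: linear_form_on_def)
  finally show ?thesis .
qed

text \<open>After expansion in both arguments, antisymmetry makes the diagonal values zero and the
  mixed ones opposite.\<close>

lemma antisym_form_eq_area:
  assumes U: "antisym_bilinear_form_on g1 U" and xy: "x \<in> g1" "y \<in> g1"
  shows "U (x, y) = U (X, Y) * area x y"
proof -
  have lin: "linear_form_on g1 (\<lambda>x. U (x, y))" "linear_form_on g1 (\<lambda>y. U (X, y))"
    "linear_form_on g1 (\<lambda>y. U (Y, y))"
    using U xy X_in Y_in unfolding antisym_bilinear_form_on_def by blast+
  have "U (x, y) = px x * U (X, y) + py x * U (Y, y)"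
    using linear_form_on_coord[OF lin(1) xy(1)] .
  moreover have "U (X, y) = px y * U (X, X) + py y * U (X, Y)"
    "U (Y, y) = px y * U (Y, X) + py y * U (Y, Y)"
    using linear_form_on_coord[OF lin(2) xy(2)] linear_form_on_coord[OF lin(3) xy(2)] .
  moreover have "U (X, X) = - U (X, X)" "U (Y, Y) = - U (Y, Y)" "U (Y, X) = - U (X, Y)"
    using U X_in Y_in unfolding antisym_bilinear_form_on_def by metis+
  ultimately show ?thesis
    by (simp add: area_def algebra_simps)
qed

text \<open>The same expansion with vector values; skew symmetry comes from polarizing
  \<open>br_self\<close>.\<close>

lemma br_coord:
  assumes "x \<in> g1" "y \<in> g1"
  shows "br x y = area x y *\<^sub>R br X Y"
proof -
  have skew: "br Y X = - br X Y"
  proof -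
    have "br (X + Y) (X + Y) = br X X + br X Y + (br Y X + br Y Y)"
      by (simp add: bilinear_ladd[OF bilinear_br] bilinear_radd[OF bilinear_br] algebra_simps)
    then show ?thesis
      by (simp add: br_self eq_neg_iff_add_eq_0 add.commute)
  qed
  have "br x y = br (px x *\<^sub>R X + py x *\<^sub>R Y) (px y *\<^sub>R X + py y *\<^sub>R Y)"
    using coord assms by simp
  also have "\<dots> = area x y *\<^sub>R br X Y"
    by (simp add: bilinear_ladd[OF bilinear_br] bilinear_radd[OF bilinear_br]
        bilinear_lmul[OF bilinear_br] bilinear_rmul[OF bilinear_br] br_self skew area_def
        algebra_simps)
  finally show ?thesis .
qed

text \<open>This holds by the uniqueness of the decomposition of \<open>br x A\<close>.\<close>

lemma chi_coord:
  assumes x: "x \<in> g1"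
  shows "chi x = px x * chi X + py x * chi Y"
proof -
  let ?c = "px x * chi X + py x * chi Y" and ?b = "px x *\<^sub>R \<beta> X + py x *\<^sub>R \<beta> Y"
  have "br x A = br (px x *\<^sub>R X + py x *\<^sub>R Y) A"
    using coord[OF x] by simp
  also have "\<dots> = ?b + ?c *\<^sub>R A"
    by (simp add: bilinear_ladd[OF bilinear_br] bilinear_lmul[OF bilinear_br] br_A algebra_simps)
  finally have eq: "\<beta> x - ?b = (?c - chi x) *\<^sub>R A"
    using br_A[OF x] by (simp add: algebra_simps)
  have "\<beta> x - ?b \<in> g1"
    by (intro subspace_diff subspace_add subspace_scale subspace_g1)
      (simp_all add: br_A x)
  moreover have "(?c - chi x) *\<^sub>R A \<in> span {A}"
    by (intro span_scale span_base) simp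
  ultimately have "(?c - chi x) *\<^sub>R A = 0"
    using eq g1_Int_g2 by (metis IntI singletonD)
  then show ?thesis using A_nonzero by simp
qed

section \<open>Cocycles as multiples of the area form\<close>

definition area_cocycle :: "real \<Rightarrow> 'g \<times> 'g \<Rightarrow> real" where
  "area_cocycle l = restrict (\<lambda>(x, y). l * area x y) (g1 \<times> g1)"

lemma area_cocycle_apply [simp]:
  "x \<in> g1 \<Longrightarrow> y \<in> g1 \<Longrightarrow> area_cocycle l (x, y) = l * area x y"
  by (simp add: area_cocycle_def)

lemma area_XY [simp]: "area X Y = 1"
  by (simp add: area_def)

lemma area_cocycle_in_cocycles: "area_cocycle l \<in> cocycles br g1 chi"
proof -
  have "area_cocycle l (br x y, z) + chi x * area_cocycle l (y, z) +
      (area_cocycle l (br y z, x) + chi y * area_cocycle l (z, x)) +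
      (area_cocycle l (br z x, y) + chi z * area_cocycle l (x, y)) = 0"
    if "x \<in> g1" "y \<in> g1" "z \<in> g1" for x y z
  proof -
    \<comment> \<open>The last factor is \<open>area (br X Y) w\<close>, a combination of
      \<open>px w\<close> and \<open>py w\<close>.\<close>
    have "area_cocycle l (br u v, w) =
        l * area u v * (px (br X Y) * py w - py (br X Y) * px w)"
      if "u \<in> g1" "v \<in> g1" "w \<in> g1" for u v w
      using that by (simp add: br_g1) (simp add: br_coord[of u v] area_def[of _ w] coord_simps algebra_simps)
    \<comment> \<open>The bracket terms and the \<open>chi\<close> terms each sum to a multiple of a
      3 by 3 determinant. Its rows are \<open>px\<close>, \<open>py\<close> and a combination of
      these, evaluated at \<open>x\<close>, \<open>y\<close>, \<open>z\<close>, so it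
      vanishes.\<close>
    then show ?thesis
      using that by (simp add: chi_coord[of x] chi_coord[of y] chi_coord[of z])
        (simp add: area_def algebra_simps)
  qed
  moreover have "antisym_bilinear_form_on g1 (area_cocycle l)"
    using subspace_add[OF subspace_g1] subspace_scale[OF subspace_g1]
    by (simp add: antisym_bilinear_form_on_def linear_form_on_def area_def coord_simps algebra_simps)
  ultimately show ?thesis
    by (simp add: cocycles_def area_cocycle_def)
qed

lemma cocycle_eq_area_cocycle:
  assumes "U \<in> cocycles br g1 chi"
  shows "U = area_cocycle (U (X, Y))"
proof
  fix p
  show "U p = area_cocycle (U (X, Y)) p"
  proof (cases "p \<in> g1 \<times> g1")
    case True
    then obtain x y where "p = (x, y)" "x \<in> g1" "y \<in> g1" by blast
    then show ?thesis
      using assms antisym_form_eq_area[of U x y] by (simp add: cocycles_def)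
  next
    case False
    \<comment> \<open>Outside \<open>g1 \<times> g1\<close> both functions take the value
      \<open>undefined\<close>.\<close>
    have "U \<in> extensional (g1 \<times> g1)"
      using assms by (simp add: cocycles_def)
    then have "U p = undefined"
      using False by (rule extensional_arb)
    then show ?thesis
      using False by (simp only: area_cocycle_def restrict_apply if_False)
  qed
qed

lemma cocycles_eq_range: "cocycles br g1 chi = range area_cocycle"
proof
  show "cocycles br g1 chi \<subseteq> range area_cocycle"
    by (rule subsetI, rule range_eqI, erule cocycle_eq_area_cocycle)
qed (simp add: image_subset_iff area_cocycle_in_cocycles)

lemma ex1_cocycle: "\<exists>!U. U \<in> cocycles br g1 chi \<and> U (X, Y) = l"
proof
  show "area_cocycle l \<in> cocycles br g1 chi \<and> area_cocycle l (X, Y) = l"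
    by (simp add: area_cocycle_in_cocycles)
qed (metis cocycle_eq_area_cocycle)

lemma area_cocycle_iso: "area_cocycle \<in> iso real_group (cocycle_group br g1 chi)"
proof (rule isoI)
  show "area_cocycle \<in> hom real_group (cocycle_group br g1 chi)"
    by (rule homI)
      (auto simp: real_group_def cocycle_group_def area_cocycle_in_cocycles
        area_cocycle_def[of "_ + _"] distrib_right intro!: restrict_ext)
  have "inj area_cocycle"
    by (rule injI) (metis X_in Y_in area_cocycle_apply area_XY mult_1_right)
  then show "bij_betw area_cocycle (carrier real_group) (carrier (cocycle_group br g1 chi))"
    by (simp add: bij_betw_def real_group_def cocycle_group_def cocycles_eq_range)
qed

lemma one_cocycle_group: "\<one>\<^bsub>cocycle_group br g1 chi\<^esub> = area_cocycle 0"
  by (auto simp: cocycle_group_def area_cocycle_def)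

text \<open>The group axioms are transported from the reals along \<open>area_cocycle\<close>; the
  transported unit is then identified with the zero cocycle.\<close>

lemma group_cocycle_group: "group (cocycle_group br g1 chi)"
proof -
  have "group (cocycle_group br g1 chi\<lparr>one := area_cocycle \<one>\<^bsub>real_group\<^esub>\<rparr>)"
    by (rule group.iso_imp_img_group[OF group_real_group area_cocycle_iso])
  moreover have "area_cocycle \<one>\<^bsub>real_group\<^esub> = \<one>\<^bsub>cocycle_group br g1 chi\<^esub>"
    by (simp add: one_cocycle_group real_group_def)
  ultimately show ?thesis by simp
qed

section \<open>Trivial cocycles and the extension group\<close>

definition W :: 'g where
  "W = br X Y + chi X *\<^sub>R Y - chi Y *\<^sub>R X"

lemma W_in: "W \<in> g1"
  unfolding W_def
  by (intro subspace_diff subspace_add subspace_scale subspace_g1 br_g1 X_in Y_in)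

text \<open>In coordinates, the bracket term and the difference of the \<open>chi\<close> terms are
  each \<open>area x y\<close> times their value at \<open>(X, Y)\<close>.\<close>

lemma coboundary_eq_area:
  assumes \<rho>: "linear_form_on g1 \<rho>" and xy: "x \<in> g1" "y \<in> g1"
  shows "\<rho> (br x y) + chi x * \<rho> y - chi y * \<rho> x = \<rho> W * area x y"
proof -
  have W: "\<rho> W = \<rho> (br X Y) + chi X * \<rho> Y - chi Y * \<rho> X"
  proof -
    have B: "br X Y \<in> g1" by (simp add: br_g1)
    \<comment> \<open>As \<open>\<rho>\<close> is only known to be linear on \<open>g1\<close>, its
      value at \<open>W\<close> is computed through coordinates.\<close>
    have "px (br X Y) = px W + chi Y" "py W = py (br X Y) + chi X"
      by (simp_all add: W_def coord_simps linear_diff[OF linear_px] linear_diff[OF linear_py])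
    then show ?thesis
      using linear_form_on_coord[OF \<rho> W_in] linear_form_on_coord[OF \<rho> B] by (simp add: algebra_simps)
  qed
  have "\<rho> (br x y) = area x y * \<rho> (br X Y)"
    using \<rho> xy by (simp add: br_coord[of x y] br_g1 linear_form_on_def)
  then show ?thesis
    using xy linear_form_on_coord[OF \<rho>, of x] linear_form_on_coord[OF \<rho>, of y]
    by (simp add: W chi_coord[of x] chi_coord[of y]) (simp add: area_def algebra_simps)
qed

text \<open>Since \<open>area X Y = 1\<close>, the coboundary equation at \<open>(X, Y)\<close>
  forces \<open>l = \<rho> W\<close>, and this equality gives it back on all of
  \<open>g1\<close>.\<close>

lemma trivial_cocycles_eq:
  "trivial_cocycles br g1 chi = area_cocycle ` {\<rho> W | \<rho>. linear_form_on g1 \<rho>}"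
proof -
  have iff: "area_cocycle l \<in> trivial_cocycles br g1 chi \<longleftrightarrow> (\<exists>\<rho>. linear_form_on g1 \<rho> \<and> l = \<rho> W)" for l
  proof -
    have "(\<forall>x\<in>g1. \<forall>y\<in>g1. area_cocycle l (x, y) = \<rho> (br x y) + chi x * \<rho> y - chi y * \<rho> x)
        \<longleftrightarrow> l = \<rho> W" if "linear_form_on g1 \<rho>" for \<rho>
    proof
      assume "\<forall>x\<in>g1. \<forall>y\<in>g1. area_cocycle l (x, y) = \<rho> (br x y) + chi x * \<rho> y - chi y * \<rho> x"
      then have "area_cocycle l (X, Y) = \<rho> W * area X Y"
        unfolding coboundary_eq_area[OF that X_in Y_in, symmetric] using X_in Y_in by blast
      then show "l = \<rho> W" by simp
    qed (simp add: coboundary_eq_area[OF that])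
    then show ?thesis
      using area_cocycle_in_cocycles unfolding trivial_cocycles_def by blast
  qed
  have sub: "trivial_cocycles br g1 chi \<subseteq> range area_cocycle"
    by (auto simp: trivial_cocycles_def cocycles_eq_range)
  show ?thesis
  proof (intro equalityI subsetI)
    fix U assume U: "U \<in> trivial_cocycles br g1 chi"
    then obtain l where "U = area_cocycle l" using sub by blast
    then show "U \<in> area_cocycle ` {\<rho> W | \<rho>. linear_form_on g1 \<rho>}"
      using U iff[of l] by blast
  qed (auto simp: iff)
qed

lemma extension_group_real:
  assumes "W = 0"
  shows "\<exists>\<phi>\<in>iso real_group (extension_group br g1 chi). \<forall>U\<in>cocycles br g1 chi.
    \<phi> (U (X, Y)) = trivial_cocycles br g1 chi #>\<^bsub>cocycle_group br g1 chi\<^esub> U"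
proof -
  let ?G = "cocycle_group br g1 chi" and ?T = "trivial_cocycles br g1 chi"
  have "\<rho> 0 = 0" if "linear_form_on g1 \<rho>" for \<rho>
    using linear_form_on_coord[OF that W_in] assms coord_simps(2)[of 0 0] coord_simps(4)[of 0 0]
    by simp
  moreover have "linear_form_on g1 (\<lambda>_. 0)"
    by (simp add: linear_form_on_def)
  ultimately have "{\<rho> W | \<rho>. linear_form_on g1 \<rho>} = {0}"
    using assms by force
  then have T: "?T = {\<one>\<^bsub>?G\<^esub>}"
    by (simp add: trivial_cocycles_eq one_cocycle_group)
  \<comment> \<open>The witness sends \<open>l\<close> to the coset of the cocycle with value
    \<open>l\<close> at \<open>(X, Y)\<close>.\<close>
  have "(\<lambda>U. ?T #>\<^bsub>?G\<^esub> U) \<circ> area_cocycle \<in> iso real_group (extension_group br g1 chi)"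
    unfolding extension_group_def T
    by (rule iso_set_trans[OF area_cocycle_iso group.r_coset_one_iso[OF group_cocycle_group]])
  then show ?thesis
    by (rule bexI[rotated]) (metis comp_apply cocycle_eq_area_cocycle)
qed

lemma trivial_extension_group:
  assumes "W \<noteq> 0"
  shows "trivial_group (extension_group br g1 chi)"
proof -
  have "\<exists>\<rho>. linear_form_on g1 \<rho> \<and> l = \<rho> W" for l
  proof -
    \<comment> \<open>The set \<open>{W}\<close> is independent, so any value at \<open>W\<close>
      extends to a linear functional.\<close>
    obtain \<rho> :: "'g \<Rightarrow> real" where "linear \<rho>" "\<rho> W = l"
      using linear_independent_extend[of "{W}" "\<lambda>_. l"] assms by auto
    then show ?thesis
      by (intro exI[of _ \<rho>]) (simp add: linear_form_on_def linear_add linear_scale)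
  qed
  then have "{\<rho> W | \<rho>. linear_form_on g1 \<rho>} = UNIV"
    by auto
  then have "trivial_cocycles br g1 chi = carrier (cocycle_group br g1 chi)"
    by (simp add: trivial_cocycles_eq cocycle_group_def cocycles_eq_range)
  then show ?thesis
    using group.trivial_group_Mod_self[OF group_cocycle_group] by (simp add: extension_group_def)
qed

end

section \<open>The value of \<open>W\<close> for each entry of the list\<close>

theorem proposition6p2:
  fixes br :: "'g::real_vector \<Rightarrow> 'g \<Rightarrow> 'g" and g1 :: "'g set" and A X Y :: 'g
    and \<beta> :: "'g \<Rightarrow> 'g" and chi :: "'g \<Rightarrow> real" and c :: list_case
  assumes "matched_pair_2_1 br g1 A \<beta> chi"
    and "span {X, Y} = g1"
    and "admissible c"
    and "of_case br g1 \<beta> chi X Y c"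
  shows "if c \<in> {Case_1_1} \<union> range Case_2_1 \<union> {Case_2_2, Case_2_3, Case_3 (-1)}
      \<union> range (Case_4_1 (-1)) \<union> {Case_4_2 (-1)} \<union> range Case_4_3
    then (\<forall>l. \<exists>!U. U \<in> cocycles br g1 chi \<and> U (X, Y) = l) \<and>
      (\<exists>\<phi>\<in>iso real_group (extension_group br g1 chi). \<forall>U\<in>cocycles br g1 chi.
        \<phi> (U (X, Y)) = trivial_cocycles br g1 chi #>\<^bsub>cocycle_group br g1 chi\<^esub> U)
    else trivial_group (extension_group br g1 chi)" (is "if ?real then _ else _")
proof -
  interpret matched_pair_basis br g1 A \<beta> chi X Y
    using assms(1,2) by (simp add: matched_pair_basis_def matched_pair_basis_axioms_def)
  have "Y \<noteq> 0"
    using independent_XY dependent_zero by auto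
  then have multiple: "a *\<^sub>R Y + Y = 0 \<longleftrightarrow> a = -1" for a
    using scaleR_left_distrib[of a 1 Y] by (auto simp: add_eq_0_iff2)
  \<comment> \<open>Where \<open>chi\<close> vanishes, \<open>W\<close> is the bracket, which is
    \<open>0\<close> or \<open>Y\<close>. Otherwise \<open>chi X = 1\<close> and
    \<open>chi Y = 0\<close>, so a bracket \<open>a *\<^sub>R Y\<close> gives
    \<open>W = (a + 1) *\<^sub>R Y\<close>; the entries 4.3 have \<open>a = -1\<close> here.\<close>
  have "W = 0 \<longleftrightarrow> ?real"
    using assms(4) \<open>Y \<noteq> 0\<close> by (cases c) (auto simp: W_def multiple)
  then show ?thesis
    using ex1_cocycle extension_group_real trivial_extension_group by auto
qed

end
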